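(* For $n\ge1$, there is an involution on the set of free Dyck paths of length $2n$ that reverses the parity of the number of flaw blocks; consequently \[\sum_{i=0}^{n}(-1)^i\frac{2i+1}{2n+1}\binom{2n+1}{n-i}=0.\]
   Context: A free Dyck path of length $2n$ is a lattice path from $(0,0)$ to $(2n,0)$ with $n$ up steps $(1,1)$ and $n$ down steps $(1,-1)$. A flaw block is a maximal segment of the path that starts and ends on the $x$-axis and is otherwise strictly below it; the number of flaw blocks equals the number of down steps from height $0$ to height $-1$. *)

theory Defs
  imports Complex_Main
begin

datatype step = Up | Down

definition free_dyck_paths :: "nat \<Rightarrow> step list set" where
  "free_dyck_paths n =
     {p. length p = 2 * n \<and> count_list p Up = n \<and> count_list p Down = n}"

fun step_rise :: "step \<Rightarrow> int" where
  "step_rise Up = 1"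
| "step_rise Down = -1"

text \<open>The ordinate of the lattice point of \<open>p\<close> with abscissa \<open>k\<close>.\<close>

definition height :: "step list \<Rightarrow> nat \<Rightarrow> int" where
  "height p k = sum_list (map step_rise (take k p))"

text \<open>A segment is given by the abscissas \<open>i < j\<close> of its endpoints. Testing lattice points
  suffices: if all interior ones are below the axis, then so is the rest of the segment, and
  \<open>j = i + 1\<close> is impossible because a step changes the height.\<close>

definition below_segment :: "step list \<Rightarrow> nat \<Rightarrow> nat \<Rightarrow> bool" where
  "below_segment p i j \<longleftrightarrow>
     i < j \<and> j \<le> length p \<and> height p i = 0 \<and> height p j = 0 \<and>
     (\<forall>k. i < k \<and> k < j \<longrightarrow> height p k < 0)"

definition flaw_blocks :: "step list \<Rightarrow> (nat \<times> nat) set" where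
  "flaw_blocks p =
     {(i, j). below_segment p i j \<and>
        (\<forall>i' j'. below_segment p i' j' \<and> i' \<le> i \<and> j \<le> j' \<longrightarrow> i' = i \<and> j' = j)}"

definition num_flaw_blocks :: "step list \<Rightarrow> nat" where
  "num_flaw_blocks p = card (flaw_blocks p)"

lemma height_Suc: "k < length p \<Longrightarrow> height p (Suc k) = height p k + step_rise (p ! k)"
  by (simp add: height_def take_Suc_conv_app_nth)

lemma sum_list_step_rise:
  "sum_list (map step_rise p) = int (count_list p Up) - int (count_list p Down)"
proof (induction p)
  case (Cons s p)
  then show ?case by (cases s) auto
qed simp

lemma height_free_dyck_path_end: "p \<in> free_dyck_paths n \<Longrightarrow> height p (2 * n) = 0"
  by (simp add: free_dyck_paths_def height_def sum_list_step_rise)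

lemma flaw_blocks_eq: "flaw_blocks p = {(i, j). below_segment p i j}"
proof -
  have "i' = i \<and> j' = j"
    if s: "below_segment p i j" and s': "below_segment p i' j'" and le: "i' \<le> i" "j \<le> j'"
    for i j i' j'
  proof -
    have "\<not> (i' < i \<and> i < j')" "\<not> (i' < j \<and> j < j')"
      using s s' unfolding below_segment_def by (metis less_irrefl)+
    moreover have "i < j" using s by (simp add: below_segment_def)
    ultimately show ?thesis using le by linarith
  qed
  then show ?thesis unfolding flaw_blocks_def by blast
qed

lemma num_flaw_blocks_eq:
  assumes "p \<in> free_dyck_paths n"
  shows "num_flaw_blocks p = card {k. k < length p \<and> height p k = 0 \<and> p ! k = Down}"
    (is "_ = card ?D")
proof -
  have inj: "inj_on fst (flaw_blocks p)"
  proof (rule inj_onI)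
    fix x y assume x: "x \<in> flaw_blocks p" and y: "y \<in> flaw_blocks p" and e: "fst x = fst y"
    obtain i j j' where xy: "x = (i, j)" "y = (i, j')" using e by (metis prod.collapse)
    have s: "below_segment p i j" "below_segment p i j'"
      using x y by (auto simp: xy flaw_blocks_eq)
    have "\<not> j < j'" "\<not> j' < j"
      using s unfolding below_segment_def by (metis less_irrefl)+
    then show "x = y" using xy by simp
  qed
  have "fst ` flaw_blocks p = ?D"
  proof (intro equalityI subsetI)
    fix i assume "i \<in> fst ` flaw_blocks p"
    then obtain j where s: "below_segment p i j" unfolding flaw_blocks_eq by force
    then have i: "i < length p" "height p i = 0" by (auto simp: below_segment_def)
    have "height p (Suc i) \<le> 0"
    proof (cases "j = Suc i")
      case False
      then have "Suc i < j" using s by (simp add: below_segment_def)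
      then show ?thesis using s by (auto simp: below_segment_def intro: less_imp_le)
    qed (use s in \<open>simp add: below_segment_def\<close>)
    then have "p ! i = Down" using i height_Suc[of i p] by (cases "p ! i") auto
    then show "i \<in> ?D" using i by simp
  next
    fix i assume "i \<in> ?D"
    then have i: "i < length p" "height p i = 0" "p ! i = Down" by auto
    define j where "j = (LEAST j. i < j \<and> height p j = 0)"
    have e: "i < length p \<and> height p (length p) = 0"
      using i height_free_dyck_path_end[OF assms] assms by (simp add: free_dyck_paths_def)
    have j: "i < j" "height p j = 0" "j \<le> length p"
      using LeastI[of "\<lambda>j. i < j \<and> height p j = 0", OF e]
        Least_le[of "\<lambda>j. i < j \<and> height p j = 0", OF e]
      by (auto simp: j_def)
    have nz: "height p k \<noteq> 0" if "i < k" "k < j" for k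
      using not_less_Least[of k "\<lambda>j. i < j \<and> height p j = 0"] that by (auto simp: j_def)
    have neg: "height p (Suc i + d) < 0" if "Suc i + d < j" for d
      using that
    proof (induction d)
      case 0
      then show ?case using i height_Suc[of i p] by simp
    next
      case (Suc d)
      have "height p (Suc (Suc i + d)) = height p (Suc i + d) + step_rise (p ! (Suc i + d))"
        using Suc.prems j by (intro height_Suc) simp
      moreover have "step_rise (p ! (Suc i + d)) \<le> 1" by (cases "p ! (Suc i + d)") auto
      moreover have "height p (Suc (Suc i + d)) \<noteq> 0" using nz Suc.prems by simp
      ultimately show ?case using Suc by simp
    qed
    have "height p k < 0" if "i < k" "k < j" for k
      using neg[of "k - Suc i"] that by simp
    then have "below_segment p i j" using i j by (simp add: below_segment_def)
    then show "i \<in> fst ` flaw_blocks p" unfolding flaw_blocks_eq by force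
  qed
  then show ?thesis unfolding num_flaw_blocks_def using card_image[OF inj] by simp
qed

end

theory Submission
  imports Defs
begin

text \<open>Reflecting the initial segment of a path up to its first return to the axis negates the
  heights on that segment only, so it preserves the abscissas of the returns and, among the steps
  leaving the axis, changes only the first one. Hence it is an involution, and the number of
  down steps from height 0 changes by exactly one.

  For the identity, the coefficient of \<open>(-1) ^ i\<close> is the ballot number
  \<open>(2n choose n - i) - (2n choose n - i - 1)\<close>; the two resulting partial alternating row sums are
  \<open>(2n - 1) choose n\<close> and \<open>(2n - 1) choose (n - 1)\<close>, which agree.\<close>

fun flip_step :: "step \<Rightarrow> step" where
  "flip_step Up = Down"
| "flip_step Down = Up"

lemma flip_step_flip_step [simp]: "flip_step (flip_step s) = s"
  by (cases s) auto

lemma flip_step_comp_flip_step [simp]: "flip_step \<circ> flip_step = id"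
  by auto

lemma flip_step_eq_Down_iff: "flip_step s = Down \<longleftrightarrow> s \<noteq> Down"
  by (cases s) auto

lemma sum_list_step_rise_flip:
  "sum_list (map step_rise (map flip_step p)) = - sum_list (map step_rise p)"
proof (induction p)
  case (Cons s p)
  then show ?case by (cases s) auto
qed simp

lemma count_list_Up_add_Down: "count_list p Up + count_list p Down = length p"
proof (induction p)
  case (Cons s p)
  then show ?case by (cases s) auto
qed simp

text \<open>The two step counts add up to the length and differ by the final height. Membership thus
  depends on heights only, which are what a reflection controls.\<close>

lemma mem_free_dyck_paths_iff:
  "p \<in> free_dyck_paths n \<longleftrightarrow> length p = 2 * n \<and> height p (2 * n) = 0"
  using count_list_Up_add_Down[of p]
  by (auto simp: free_dyck_paths_def height_def sum_list_step_rise)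

definition first_return :: "step list \<Rightarrow> nat" where
  "first_return p = (LEAST r. 0 < r \<and> height p r = 0)"

text \<open>The abscissa \<open>r\<close> is a parameter, so that undoing a flip at a fixed
  \<open>r\<close> can be separated from the fact that flipping preserves the first return.\<close>

definition flip_prefix :: "nat \<Rightarrow> step list \<Rightarrow> step list" where
  "flip_prefix r p = map flip_step (take r p) @ drop r p"

lemma length_flip_prefix [simp]: "length (flip_prefix r p) = length p"
  by (simp add: flip_prefix_def)

lemma flip_prefix_flip_prefix:
  "r \<le> length p \<Longrightarrow> flip_prefix r (flip_prefix r p) = p"
  by (simp add: flip_prefix_def min_def)

lemma nth_flip_prefix:
  "k < length p \<Longrightarrow> flip_prefix r p ! k = (if k < r then flip_step (p ! k) else p ! k)"
  by (auto simp: flip_prefix_def nth_append min_def)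

text \<open>Since \<open>height p r = 0\<close>, the negated prefix still ends on the axis, so the
  unchanged remainder starts from the same height as before.\<close>

lemma height_flip_prefix:
  assumes "r \<le> length p" "height p r = 0"
  shows "height (flip_prefix r p) k = (if k \<le> r then - height p k else height p k)"
proof (cases "k \<le> r")
  case True
  then have "take k (flip_prefix r p) = map flip_step (take k p)"
    using assms by (simp add: flip_prefix_def take_map min_def)
  then show ?thesis
    using True sum_list_step_rise_flip[of "take k p"] by (simp add: height_def)
next
  case False
  then have k: "k = r + (k - r)" by simp
  have "take k (flip_prefix r p) = map flip_step (take r p) @ take (k - r) (drop r p)"
    using False assms by (simp add: flip_prefix_def min_def)
  moreover have "take k p = take r p @ take (k - r) (drop r p)"
    by (subst k, rule take_add)
  ultimately show ?thesis
    using False assms sum_list_step_rise_flip[of "take r p"] by (simp add: height_def)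
qed

lemma first_return:
  assumes "p \<in> free_dyck_paths n" "n \<ge> 1"
  shows "0 < first_return p" "height p (first_return p) = 0" "first_return p \<le> length p"
proof -
  \<comment> \<open>The endpoint of the path witnesses that a return exists, so the
    \<open>LEAST\<close> is meaningful; this is where \<open>n\<close> must be positive.\<close>
  have e: "0 < 2 * n \<and> height p (2 * n) = 0"
    using assms by (simp add: mem_free_dyck_paths_iff)
  show "0 < first_return p" "height p (first_return p) = 0" "first_return p \<le> length p"
    using LeastI[of "\<lambda>r. 0 < r \<and> height p r = 0", OF e]
      Least_le[of "\<lambda>r. 0 < r \<and> height p r = 0", OF e] assms
    by (auto simp: first_return_def mem_free_dyck_paths_iff)
qed

lemma height_before_first_return:
  "0 < k \<Longrightarrow> k < first_return p \<Longrightarrow> height p k \<noteq> 0"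
  using not_less_Least[of k "\<lambda>r. 0 < r \<and> height p r = 0"] by (auto simp: first_return_def)

lemma even_card_insert_iff:
  "finite A \<Longrightarrow> a \<notin> A \<Longrightarrow> even (card (insert a A)) \<longleftrightarrow> odd (card A)"
  by simp

lemma flip_first_return:
  assumes p: "p \<in> free_dyck_paths n" and n: "n \<ge> 1"
  defines "q \<equiv> flip_prefix (first_return p) p"
  shows "q \<in> free_dyck_paths n"
    and "first_return q = first_return p"
    and "even (num_flaw_blocks q) \<longleftrightarrow> odd (num_flaw_blocks p)"
proof -
  let ?r = "first_return p"
  note r = first_return[OF p n]
  have hq: "height q k = (if k \<le> ?r then - height p k else height p k)" for k
    using height_flip_prefix r unfolding q_def by blast
  have zero: "height q k = 0 \<longleftrightarrow> height p k = 0" for k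
    by (simp add: hq)
  show q: "q \<in> free_dyck_paths n"
    using p zero by (simp add: mem_free_dyck_paths_iff q_def)
  show "first_return q = ?r"
    by (simp add: first_return_def zero)
  define D where "D s = {k. k < length s \<and> height s k = 0 \<and> s ! k = Down}" for s
  \<comment> \<open>The down steps leaving the axis at a positive abscissa turn out to be common to
    \<open>p\<close> and \<open>q\<close>; only abscissa 0 tells the two sets apart.\<close>
  define E where "E = D p - {0}"
  have len: "0 < length p" "length q = length p"
    using p n by (auto simp: mem_free_dyck_paths_iff q_def)
  have q0: "q ! 0 = Down \<longleftrightarrow> p ! 0 \<noteq> Down"
    using len r by (simp add: q_def nth_flip_prefix flip_step_eq_Down_iff)
  \<comment> \<open>Strictly between 0 and the first return no height is zero, so \<open>k\<close>
    lies in neither set; from the first return on, the steps are unchanged.\<close>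
  have same: "k \<in> D q \<longleftrightarrow> k \<in> D p" if "0 < k" for k
    using height_before_first_return[OF that, of p] zero[of k]
    by (auto simp: D_def q_def nth_flip_prefix split: if_splits)
  have zero_mem: "0 \<in> D q \<longleftrightarrow> 0 \<notin> D p"
    using len q0 by (simp add: D_def height_def)
  have E: "finite E" "0 \<notin> E" by (auto simp: E_def D_def)
  have E_q: "E = D q - {0}"
    using same by (auto simp: E_def)
  have "even (card (D q)) \<longleftrightarrow> odd (card (D p))"
  proof (cases "0 \<in> D p")
    case True
    then have "D p = insert 0 E" "D q = E"
      using zero_mem E_q by (auto simp: E_def)
    then show ?thesis using even_card_insert_iff[OF E] by simp
  next
    case False
    then have "D p = E" "D q = insert 0 E"
      using zero_mem E_q by (auto simp: E_def)
    then show ?thesis using even_card_insert_iff[OF E] by simp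
  qed
  then show "even (num_flaw_blocks q) \<longleftrightarrow> odd (num_flaw_blocks p)"
    using num_flaw_blocks_eq[OF p] num_flaw_blocks_eq[OF q] by (simp add: D_def)
qed

text \<open>With \<open>k = n - i\<close>, split \<open>2 * i + 1\<close> as
  \<open>(2 * n + 1 - k) - k\<close> and absorb each factor into the binomial coefficient. The
  conditional stands for a binomial coefficient with lower index -1: at \<open>i = n\<close>,
  truncated subtraction would give 1 instead of 0.\<close>

lemma ballot_number_eq:
  assumes "i \<le> n"
  shows "real (2 * i + 1) / real (2 * n + 1) * real ((2 * n + 1) choose (n - i))
    = real (2 * n choose (n - i)) - (if i < n then real (2 * n choose (n - 1 - i)) else 0)"
proof -
  define k where "k = n - i"
  have n: "n = k + i" using assms by (simp add: k_def)
  have upper: "real (2 * n + 1 - k) * real ((2 * n + 1) choose k)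
      = real (2 * n + 1) * real (2 * n choose k)"
    using binomial_absorb_comp[of "2 * n + 1" k] by (metis add_diff_cancel_right' of_nat_mult)
  have lower: "real k * real ((2 * n + 1) choose k)
      = real (2 * n + 1) * (if k = 0 then 0 else real (2 * n choose (k - 1)))"
  proof (cases k)
    case (Suc m)
    have "Suc m * (Suc (2 * n) choose Suc m) = Suc (2 * n) * (2 * n choose m)"
      by (rule Suc_times_binomial)
    from arg_cong[OF this, of real] show ?thesis
      unfolding Suc of_nat_mult by simp
  qed simp
  have "real (2 * i + 1) = real (2 * n + 1 - k) - real k"
    by (simp add: n)
  then have "real (2 * i + 1) * real ((2 * n + 1) choose k) = real (2 * n + 1) *
      (real (2 * n choose k) - (if k = 0 then 0 else real (2 * n choose (k - 1))))"
    using upper lower by (simp only: left_diff_distrib right_diff_distrib)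
  then have "real (2 * i + 1) / real (2 * n + 1) * real ((2 * n + 1) choose k)
      = real (2 * n choose k) - (if k = 0 then 0 else real (2 * n choose (k - 1)))"
    by (simp only: times_divide_eq_left nonzero_mult_div_cancel_left of_nat_eq_0_iff)
  moreover have "k = 0 \<longleftrightarrow> \<not> i < n" "k - 1 = n - 1 - i"
    using assms by (auto simp: k_def)
  ultimately show ?thesis by (auto simp: k_def)
qed

text \<open>By Pascal's rule each term splits into two neighbours in row \<open>N\<close>, and the
  sum telescopes.\<close>

lemma partial_alternating_row_sum:
  "(\<Sum>k\<le>m. (-1) ^ k * real (Suc N choose k)) = (-1) ^ m * real (N choose m)"
  by (induction m) (auto simp: algebra_simps)

text \<open>Reading the sum backwards contributes a factor \<open>(-1) ^ m\<close>, which cancels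
  the sign of the forward sum.\<close>

lemma partial_alternating_row_sum_rev:
  "(\<Sum>i\<le>m. (-1) ^ i * real (Suc N choose (m - i))) = real (N choose m)"
proof -
  have "(\<Sum>i\<le>m. (-1) ^ i * real (Suc N choose (m - i)))
      = (\<Sum>k\<le>m. (-1) ^ (m - k) * real (Suc N choose k))"
    using sum.nat_diff_reindex[of "\<lambda>k. (-1) ^ (m - k) * real (Suc N choose k)" "Suc m"]
    by (simp add: lessThan_Suc_atMost)
  also have "\<dots> = (\<Sum>k\<le>m. (-1) ^ m * ((-1) ^ k * real (Suc N choose k)))"
    by (intro sum.cong) (auto simp: minus_one_power_iff)
  also have "\<dots> = real (N choose m)"
    unfolding sum_distrib_left[symmetric] partial_alternating_row_sum
    by (simp flip: mult.assoc power_add)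
  finally show ?thesis .
qed

lemma alternating_ballot_sum:
  assumes "n \<ge> 1"
  shows "(\<Sum>i = 0..n. (-1) ^ i * (real (2 * i + 1) / real (2 * n + 1))
              * real ((2 * n + 1) choose (n - i))) = 0"
proof -
  obtain m where n: "n = Suc m" using assms by (cases n) auto
  have "(\<Sum>i = 0..n. (-1) ^ i * (real (2 * i + 1) / real (2 * n + 1))
              * real ((2 * n + 1) choose (n - i)))
      = (\<Sum>i\<le>n. (-1) ^ i * (real (2 * n choose (n - i))
          - (if i < n then real (2 * n choose (n - 1 - i)) else 0)))"
    unfolding atMost_atLeast0
    by (intro sum.cong refl, subst ballot_number_eq[symmetric]) (auto simp: mult.assoc)
  also have "\<dots> = (\<Sum>i\<le>n. (-1) ^ i * real (2 * n choose (n - i)))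
      - (\<Sum>i\<le>n. (-1) ^ i * (if i < n then real (2 * n choose (n - 1 - i)) else 0))"
    by (simp only: right_diff_distrib sum_subtractf)
  also have "(\<Sum>i\<le>n. (-1) ^ i * (if i < n then real (2 * n choose (n - 1 - i)) else 0))
      = (\<Sum>i\<le>m. (-1) ^ i * real (2 * n choose (m - i)))"
    unfolding n sum.atMost_Suc by simp
  \<comment> \<open>In this form the row sums apply with \<open>N = 2 * m + 1\<close>; they leave
    the two equal middle entries of that row, at \<open>m + 1\<close> and \<open>m\<close>.\<close>
  also have "2 * n = Suc (Suc (2 * m))" by (simp add: n)
  finally show ?thesis
    using binomial_symmetric[of m "Suc (2 * m)"]
    by (simp only: partial_alternating_row_sum_rev) (simp add: n)
qed

theorem theorem4p1:
  fixes n :: nat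
  assumes "n \<ge> 1"
  shows "(\<exists>\<phi> :: step list \<Rightarrow> step list.
            \<forall>p \<in> free_dyck_paths n.
              \<phi> p \<in> free_dyck_paths n \<and> \<phi> (\<phi> p) = p \<and>
              (even (num_flaw_blocks (\<phi> p)) \<longleftrightarrow> odd (num_flaw_blocks p)))
       \<and> (\<Sum>i = 0..n. (-1) ^ i * (real (2 * i + 1) / real (2 * n + 1))
              * real ((2 * n + 1) choose (n - i))) = 0"
proof
  show "\<exists>\<phi> :: step list \<Rightarrow> step list.
            \<forall>p \<in> free_dyck_paths n.
              \<phi> p \<in> free_dyck_paths n \<and> \<phi> (\<phi> p) = p \<and>
              (even (num_flaw_blocks (\<phi> p)) \<longleftrightarrow> odd (num_flaw_blocks p))"
    \<comment> \<open>The flipped path has the same first return, so the second application flips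
      the same prefix back.\<close>
    using flip_first_return[OF _ assms] first_return(3)[OF _ assms]
    by (intro exI[of _ "\<lambda>p. flip_prefix (first_return p) p"])
      (simp add: flip_prefix_flip_prefix)
qed (rule alternating_ballot_sum[OF assms])

end
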